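(* (a) For every integer $k \ge 4$ there exists a symmetric numerical semigroup with embedding dimension $k$ that is not cyclotomic. (b) For every odd integer $F \ge 9$ there exists a symmetric numerical semigroup with Frobenius number $F$ that is not cyclotomic.
   Context: A numerical semigroup $S$ is a submonoid of $(\mathbb{N},+)$ ($\mathbb{N}=\{0,1,2,\dots\}$) with finite complement $\mathcal{G}=\mathbb{N}\setminus S$. Its Frobenius number $\mathrm{F}(S)$ is the largest element of $\mathcal{G}$; its embedding dimension is the cardinality of its unique minimal generating set. $S$ is symmetric if $S \cup (\mathrm{F}(S)-S)=\mathbb{Z}$, where $\mathrm{F}(S)-S=\{\mathrm{F}(S)-s : s\in S\}$. The semigroup polynomial of $S$ is $\mathrm{P}_S(x)=1+(x-1)\sum_{g\in\mathcal{G}}x^g$. A Kronecker polynomial is a monic polynomial in $\mathbb{Z}[x]$ all of whose complex roots lie in the closed unit disc. $S$ is called cyclotomic if $\mathrm{P}_S$ is a Kronecker polynomial. *)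

theory Defs
  imports Complex_Main "HOL-Computational_Algebra.Polynomial"
begin

definition add_submonoid :: "nat set \<Rightarrow> bool" where
  "add_submonoid S \<longleftrightarrow> 0 \<in> S \<and> (\<forall>a\<in>S. \<forall>b\<in>S. a + b \<in> S)"

definition gaps :: "nat set \<Rightarrow> nat set" where
  "gaps S = UNIV - S"

definition numerical_semigroup :: "nat set \<Rightarrow> bool" where
  "numerical_semigroup S \<longleftrightarrow> add_submonoid S \<and> finite (gaps S)"

text \<open>For the semigroup of all naturals, which has no gaps, we use the customary value -1
  (the largest integer outside the semigroup). For this reason the Frobenius number is an integer.\<close>

definition frobenius_number :: "nat set \<Rightarrow> int" where
  "frobenius_number S = (if gaps S = {} then -1 else int (Max (gaps S)))"

text \<open>The term \<open>add_submonoid hull A\<close> is the submonoid generated by \<open>A\<close>; minimality is with respect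
  to inclusion.\<close>

definition minimal_generating_set :: "nat set \<Rightarrow> nat set \<Rightarrow> bool" where
  "minimal_generating_set S A \<longleftrightarrow>
     add_submonoid hull A = S \<and> (\<forall>B. B \<subset> A \<longrightarrow> add_submonoid hull B \<noteq> S)"

text \<open>The minimal generating set exists, is unique and is finite for every numerical semigroup:
  see \<open>ex1_minimal_generating_set\<close> and \<open>finite_minimal_generating_set\<close> below.\<close>

definition embedding_dimension :: "nat set \<Rightarrow> nat" where
  "embedding_dimension S = card (THE A. minimal_generating_set S A)"

definition symmetric_semigroup :: "nat set \<Rightarrow> bool" where
  "symmetric_semigroup S \<longleftrightarrow>
     int ` S \<union> (\<lambda>s. frobenius_number S - int s) ` S = (UNIV :: int set)"

definition semigroup_polynomial :: "nat set \<Rightarrow> int poly" where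
  "semigroup_polynomial S = 1 + [:-1, 1:] * (\<Sum>g\<in>gaps S. monom 1 g)"

definition kronecker_polynomial :: "int poly \<Rightarrow> bool" where
  "kronecker_polynomial p \<longleftrightarrow>
     lead_coeff p = 1 \<and> (\<forall>z::complex. poly (map_poly of_int p) z = 0 \<longrightarrow> norm z \<le> 1)"

definition cyclotomic_semigroup :: "nat set \<Rightarrow> bool" where
  "cyclotomic_semigroup S \<longleftrightarrow> kronecker_polynomial (semigroup_polynomial S)"

definition irreducible_elements :: "nat set \<Rightarrow> nat set" where
  "irreducible_elements S = {s \<in> S. s \<noteq> 0 \<and> (\<forall>a\<in>S. \<forall>b\<in>S. s = a + b \<longrightarrow> a = 0 \<or> b = 0)}"

lemma add_submonoid_hull: "add_submonoid (add_submonoid hull A)"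
  by (rule hull_in) (auto simp: add_submonoid_def)

lemma zero_in_hull: "0 \<in> add_submonoid hull A"
  using add_submonoid_hull[of A] add_submonoid_def[of "add_submonoid hull A"] by blast

lemma add_in_hull:
  "a \<in> add_submonoid hull A \<Longrightarrow> b \<in> add_submonoid hull A \<Longrightarrow> a + b \<in> add_submonoid hull A"
  using add_submonoid_hull[of A] add_submonoid_def[of "add_submonoid hull A"] by blast

lemma hull_irreducible_elements:
  assumes "add_submonoid S"
  shows "add_submonoid hull irreducible_elements S = S"
proof
  show "add_submonoid hull irreducible_elements S \<subseteq> S"
    by (rule hull_minimal) (use assms in \<open>auto simp: irreducible_elements_def\<close>)
next
  have "s \<in> S \<Longrightarrow> s \<in> add_submonoid hull irreducible_elements S" for s
  proof (induction s rule: less_induct)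
    case (less s)
    consider "s = 0" | "s \<in> irreducible_elements S"
      | a b where "a \<in> S" "b \<in> S" "s = a + b" "a \<noteq> 0" "b \<noteq> 0"
      using less.prems by (auto simp: irreducible_elements_def)
    then show ?case
    proof cases
      case 1
      then show ?thesis
        by (simp add: zero_in_hull)
    next
      case 2
      then show ?thesis by (rule hull_inc)
    next
      case 3
      then have "a \<in> add_submonoid hull irreducible_elements S"
        "b \<in> add_submonoid hull irreducible_elements S"
        using less.IH by auto
      then show ?thesis
        by (simp add: 3(3) add_in_hull)
    qed
  qed
  then show "S \<subseteq> add_submonoid hull irreducible_elements S" by blast
qed

lemma irreducible_elements_subset:
  assumes "add_submonoid hull A = S"
  shows "irreducible_elements S \<subseteq> A"
proof
  fix s assume s: "s \<in> irreducible_elements S"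
  show "s \<in> A"
  proof (rule ccontr)
    assume "s \<notin> A"
    have S: "add_submonoid S" using add_submonoid_hull[of A] unfolding assms .
    have "add_submonoid (S - {s})"
      unfolding add_submonoid_def
    proof (intro conjI ballI)
      show "0 \<in> S - {s}" using S s by (auto simp: add_submonoid_def irreducible_elements_def)
    next
      fix a b assume ab: "a \<in> S - {s}" "b \<in> S - {s}"
      have "a + b \<noteq> s"
      proof
        assume "a + b = s"
        then have "a = 0 \<or> b = 0" using ab s unfolding irreducible_elements_def by blast
        then show False using ab \<open>a + b = s\<close> by force
      qed
      then show "a + b \<in> S - {s}" using S ab by (auto simp: add_submonoid_def)
    qed
    moreover have "A \<subseteq> S - {s}"
      using assms hull_subset[of A add_submonoid] \<open>s \<notin> A\<close> by blast
    ultimately have "add_submonoid hull A \<subseteq> S - {s}" by (simp add: hull_minimal)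
    then show False using assms s by (auto simp: irreducible_elements_def)
  qed
qed

lemma minimal_generating_set_iff:
  assumes "add_submonoid S"
  shows "minimal_generating_set S A \<longleftrightarrow> A = irreducible_elements S"
proof
  assume A: "minimal_generating_set S A"
  then have "add_submonoid hull A = S"
    by (simp add: minimal_generating_set_def)
  then have "irreducible_elements S \<subseteq> A"
    by (rule irreducible_elements_subset)
  moreover have "\<not> irreducible_elements S \<subset> A"
    using A hull_irreducible_elements[OF assms] by (auto simp: minimal_generating_set_def)
  ultimately show "A = irreducible_elements S"
    by (auto simp: psubset_eq)
next
  assume A: "A = irreducible_elements S"
  have "add_submonoid hull B \<noteq> S" if "B \<subset> A" for B
    using irreducible_elements_subset[of B S] that A by (meson psubsetE)
  then show "minimal_generating_set S A"
    using hull_irreducible_elements[OF assms] A by (simp add: minimal_generating_set_def)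
qed

lemma ex1_minimal_generating_set:
  assumes "numerical_semigroup S"
  shows "\<exists>!A. minimal_generating_set S A"
  using assms by (simp add: numerical_semigroup_def minimal_generating_set_iff)

lemma finite_minimal_generating_set:
  assumes "numerical_semigroup S" and "minimal_generating_set S A"
  shows "finite A"
proof -
  have A: "A = irreducible_elements S"
    using assms by (simp add: numerical_semigroup_def minimal_generating_set_iff)
  obtain c where c: "\<And>g. g \<in> gaps S \<Longrightarrow> g < c" "c > 0"
  proof -
    have "finite (gaps S)" using assms(1) by (simp add: numerical_semigroup_def)
    then obtain d where "\<forall>g\<in>gaps S. g < d" by (meson finite_nat_set_iff_bounded)
    then show ?thesis using that[of "Suc d"] less_SucI by blast
  qed
  have "s < 2 * c" if "s \<in> A" for s
  proof (rule ccontr)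
    assume "\<not> s < 2 * c"
    define t where "t = s - c"
    have t: "s = c + t" "t \<ge> c" using \<open>\<not> s < 2 * c\<close> unfolding t_def by linarith+
    have "n \<in> S" if "n \<ge> c" for n
      using c(1)[of n] that by (auto simp: gaps_def)
    then have "c \<in> S" "t \<in> S" using t(2) by auto
    then have "c = 0 \<or> t = 0"
      using \<open>s \<in> A\<close> t(1) unfolding A irreducible_elements_def by blast
    then show False using c(2) t(2) by auto
  qed
  then show ?thesis by (meson finite_nat_set_iff_bounded)
qed

end

theory Submission
  imports Defs "HOL-Computational_Algebra.Computational_Algebra"
begin

text \<open>
  Both parts are witnessed by \<open>S = {0} \<union> {k..2k-2} \<union> {2k..}\<close> with \<open>k \<ge> 5\<close>, which is symmetric with
  Frobenius number \<open>2k - 1\<close> and embedding dimension \<open>k - 1\<close>. Its polynomial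
  \<open>P = 1 - x + x^k - x^(2k-1) + x^(2k)\<close> is self-reciprocal, so it equals the product of \<open>1 - r x\<close>
  over its roots \<open>r\<close>, and Newton's identities \<open>P' = - P * (\<Sum>n. p (n+1) x^n)\<close> determine the power
  sums \<open>p n\<close> of the roots. One finds \<open>p (2k+3) = 2k + 4\<close>, whereas \<open>2k\<close> roots in the closed unit
  disc have power sums of modulus at most \<open>2k\<close>.
\<close>

section \<open>Power sums of roots\<close>

text \<open>Geometric series: r + r^2 X + r^3 X^2 + ... equals r / (1 - r X), which is minus the
  logarithmic derivative of the factor 1 - r X.\<close>

lemma one_minus_const_X_mult_powers:
  fixes r :: "'a::comm_ring_1"
  shows "(1 - fps_const r * fps_X) * Abs_fps (\<lambda>n. r ^ Suc n) = fps_const r"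
proof (rule fps_ext)
  fix n
  show "((1 - fps_const r * fps_X) * Abs_fps (\<lambda>n. r ^ Suc n)) $ n = fps_const r $ n"
    by (cases n) (simp_all add: algebra_simps)
qed

text \<open>Newton's identities as a generating function: the logarithmic derivative turns the
  product into a sum of geometric series. Multiplying out avoids division, so any commutative ring
  will do.\<close>

lemma fps_deriv_prod_mset_one_minus:
  fixes A :: "'a::comm_ring_1 multiset"
  shows "fps_deriv (\<Prod>r\<in>#A. 1 - fps_const r * fps_X) =
    - ((\<Prod>r\<in>#A. 1 - fps_const r * fps_X) * Abs_fps (\<lambda>n. \<Sum>r\<in>#A. r ^ Suc n))"
proof (induction A)
  case empty
  then show ?case by (simp add: fps_eq_iff)
next
  case (add r A)
  let ?f = "\<Prod>r\<in>#A. 1 - fps_const r * fps_X"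
  let ?l = "1 - fps_const r * fps_X"
  let ?T = "Abs_fps (\<lambda>n. \<Sum>r\<in>#A. r ^ Suc n)"
  have T: "Abs_fps (\<lambda>n. \<Sum>s\<in>#add_mset r A. s ^ Suc n) = Abs_fps (\<lambda>n. r ^ Suc n) + ?T"
    by (simp add: fps_eq_iff)
  have factor: "- (a * b * c) - a * (c * d) = - (a * c * (b + d))" for a b c d :: "'a fps"
    by (simp add: algebra_simps)
  have "fps_deriv (?l * ?f) = - (fps_const r * ?f) - ?l * (?f * ?T)"
    by (simp add: add.IH del: fps_const_neg)
  \<comment> \<open>Writing the constant r as \<open>?l\<close> times its geometric series exposes
    the common factor \<open>?l * ?f\<close>.\<close>
  also have "\<dots> = - (?l * Abs_fps (\<lambda>n. r ^ Suc n) * ?f) - ?l * (?f * ?T)"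
    by (simp only: one_minus_const_X_mult_powers)
  also have "\<dots> = - (?l * ?f * (Abs_fps (\<lambda>n. r ^ Suc n) + ?T))"
    by (rule factor)
  finally show ?case
    unfolding T by simp
qed

text \<open>Reversing coefficients is multiplicative and turns each X - r into 1 - r X.\<close>

lemma fps_deriv_reflect_poly_prod_mset:
  fixes A :: "'a::{comm_ring_1,ring_no_zero_divisors} multiset"
  defines "p \<equiv> \<Prod>r\<in>#A. [:-r, 1:]"
  shows "fps_deriv (fps_of_poly (reflect_poly p)) =
    - (fps_of_poly (reflect_poly p) * Abs_fps (\<lambda>n. \<Sum>r\<in>#A. r ^ Suc n))"
proof -
  have "fps_of_poly (reflect_poly p) = (\<Prod>r\<in>#A. 1 - fps_const r * fps_X)"
    unfolding p_def
  proof (induction A)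
    case (add r A)
    have "reflect_poly [:-r, 1:] = [:1, -r:]"
      by (simp add: reflect_poly_def)
    then have "fps_of_poly (reflect_poly [:-r, 1:]) = 1 - fps_const r * fps_X"
      by (simp add: fps_of_poly_pCons fps_eq_iff)
    with add show ?case
      by (simp only: image_mset_add_mset prod_mset.add_mset reflect_poly_mult fps_of_poly_mult)
  qed simp
  then show ?thesis by (simp add: fps_deriv_prod_mset_one_minus)
qed

lemma norm_sum_mset_power_le:
  fixes A :: "'a::real_normed_div_algebra multiset"
  assumes "\<And>r. r \<in># A \<Longrightarrow> norm r \<le> 1"
  shows "norm (\<Sum>r\<in>#A. r ^ n) \<le> of_nat (size A)"
  using assms
proof (induction A)
  case (add r A)
  have "norm (r ^ n) \<le> 1"
    using add.prems[of r] by (simp add: norm_power power_le_one)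
  moreover have "norm (\<Sum>r\<in>#A. r ^ n) \<le> of_nat (size A)"
    using add by simp
  ultimately show ?case
    using norm_triangle_ineq[of "r ^ n" "\<Sum>r\<in>#A. r ^ n"] by simp
qed simp

section \<open>The polynomial\<close>

definition witness_poly :: "nat \<Rightarrow> 'a::comm_ring_1 poly" where
  "witness_poly k = 1 - monom 1 1 + monom 1 k - monom 1 (2 * k - 1) + monom 1 (2 * k)"

lemma coeff_witness_poly:
  "coeff (witness_poly k) n = of_bool (n = 0) - of_bool (n = 1) + of_bool (n = k)
     - of_bool (n = 2 * k - 1) + of_bool (n = 2 * k)"
  by (simp add: witness_poly_def coeff_monom)

lemma degree_witness_poly:
  assumes "k \<ge> 2"
  shows "degree (witness_poly k :: 'a::comm_ring_1 poly) = 2 * k"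
proof (rule antisym)
  show "degree (witness_poly k :: 'a poly) \<le> 2 * k"
    using assms by (intro degree_le) (auto simp: coeff_witness_poly)
  show "2 * k \<le> degree (witness_poly k :: 'a poly)"
    using assms by (intro le_degree) (auto simp: coeff_witness_poly)
qed

text \<open>The map n \<mapsto> 2k - n permutes the exponents 0, 1, k, 2k - 1, 2k and preserves
  their signs.\<close>

lemma reflect_witness_poly:
  assumes "k \<ge> 2"
  shows "reflect_poly (witness_poly k) = (witness_poly k :: 'a::comm_ring_1 poly)"
  using assms
  by (intro poly_eqI) (auto simp: coeff_reflect_poly degree_witness_poly coeff_witness_poly)

lemma map_poly_of_int_witness_poly:
  "map_poly of_int (witness_poly k) = (witness_poly k :: 'a::comm_ring_1 poly)"
  by (intro poly_eqI) (simp add: coeff_map_poly coeff_witness_poly)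

text \<open>Compare the coefficients of X^n on both sides; each monomial of P shifts
  \<open>T\<close>. The case distinctions guard against truncated subtraction.\<close>

lemma witness_poly_power_sum_recurrence:
  fixes T :: "nat \<Rightarrow> 'a::comm_ring_1"
  assumes "fps_deriv (fps_of_poly (witness_poly k)) = - (fps_of_poly (witness_poly k) * Abs_fps T)"
  shows "T n = (if n < 1 then 0 else T (n - 1)) - (if n < k then 0 else T (n - k))
    + (if n < 2 * k - 1 then 0 else T (n - (2 * k - 1))) - (if n < 2 * k then 0 else T (n - 2 * k))
    - of_nat (Suc n) * coeff (witness_poly k) (Suc n)"
proof -
  have P: "fps_of_poly (witness_poly k) =
    1 - fps_X ^ 1 + fps_X ^ k - fps_X ^ (2 * k - 1) + (fps_X ^ (2 * k) :: 'a fps)"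
    by (simp add: witness_poly_def fps_of_poly_add fps_of_poly_diff fps_of_poly_monom')
  have PT: "fps_of_poly (witness_poly k) * Abs_fps T =
    Abs_fps T - fps_X ^ 1 * Abs_fps T + fps_X ^ k * Abs_fps T - fps_X ^ (2 * k - 1) * Abs_fps T
    + fps_X ^ (2 * k) * Abs_fps T"
    unfolding P by (simp only: ring_distribs mult_1_left)
  have "of_nat (Suc n) * coeff (witness_poly k) (Suc n) = fps_deriv (fps_of_poly (witness_poly k)) $ n"
    by simp
  also have "\<dots> = - (T n - (if n < 1 then 0 else T (n - 1)) + (if n < k then 0 else T (n - k))
    - (if n < 2 * k - 1 then 0 else T (n - (2 * k - 1))) + (if n < 2 * k then 0 else T (n - 2 * k)))"
    unfolding assms PT fps_neg_nth fps_add_nth fps_sub_nth fps_X_power_mult_nth by simp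
  finally show ?thesis by simp
qed

lemma witness_poly_power_sum:
  fixes T :: "nat \<Rightarrow> 'a::comm_ring_1"
  assumes "k \<ge> 5"
    and "fps_deriv (fps_of_poly (witness_poly k)) = - (fps_of_poly (witness_poly k) * Abs_fps T)"
  shows "T (2 * k + 2) = of_nat (2 * k + 4)"
proof -
  note rec = witness_poly_power_sum_recurrence[OF assms(2)]
  have low: "T n = 1" if "n < k - 1" for n
    using that
  proof (induction n)
    case 0
    then show ?case using assms(1) by (subst rec) (auto simp: coeff_witness_poly)
  next
    case (Suc n)
    then show ?case using assms(1) by (subst rec) (auto simp: coeff_witness_poly)
  qed
  \<comment> \<open>At n = k - 1 the term k x^(k-1) of P' subtracts k; after that, each step
    subtracts \<open>T (n - k) = 1\<close>.\<close>
  have mid: "T n = - of_nat n" if "k - 1 \<le> n" "n \<le> 2 * k - 3" for n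
    using that
  proof (induction n rule: dec_induct)
    case base
    have "T (k - 2) = 1" using assms(1) by (intro low) simp
    then show ?case
      using assms(1) by (subst rec) (auto simp: coeff_witness_poly of_nat_diff numeral_2_eq_2)
  next
    case (step n)
    have "T (Suc n - k) = 1" using step assms(1) by (intro low) auto
    moreover have "T n = - of_nat n" using step by simp
    ultimately show ?case
      using step assms(1) by (subst rec) (auto simp: coeff_witness_poly)
  qed
  \<comment> \<open>This substitution clears subtraction from the indices. The next two values, at
    2k - 2 and 2k - 1, still receive a term of P'.\<close>
  obtain m where k: "k = m + 5"
    using assms(1) le_Suc_ex by (metis add.commute)
  have "T (2 * m + 8) = T (2 * m + 7) - T (m + 3) + of_nat (2 * m + 9)"
    by (subst rec) (simp add: k coeff_witness_poly add.commute)
  with mid[of "2 * m + 7"] low[of "m + 3"] have t: "T (2 * m + 8) = 1"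
    by (simp add: k)
  have "T (2 * m + 9) = T (2 * m + 8) - T (m + 4) + T 0 - of_nat (2 * m + 10)"
    by (subst rec) (simp add: k coeff_witness_poly add.commute)
  with t mid[of "m + 4"] low[of 0] have t': "T (2 * m + 9) = - of_nat m - 4"
    by (simp add: k)
  \<comment> \<open>From index 2k on, P' contributes nothing. The last two terms cancel, both being
    1, so each step adds \<open>- T (n - k)\<close>, which is n - k by \<open>mid\<close>.\<close>
  have "T (2 * m + 10) = T (2 * m + 9) - T (m + 5) + T 1 - T 0"
    by (subst rec) (simp add: k coeff_witness_poly add.commute)
  with t' mid[of "m + 5"] low[of 0] low[of 1] have t'': "T (2 * m + 10) = 1"
    by (simp add: k)
  have "T (2 * m + 11) = T (2 * m + 10) - T (m + 6) + T 2 - T 1"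
    by (subst rec) (simp add: k coeff_witness_poly add.commute)
  with t'' mid[of "m + 6"] low[of 1] low[of 2] have t''': "T (2 * m + 11) = of_nat m + 7"
    by (simp add: k)
  \<comment> \<open>The value \<open>T 3 = 1\<close> comes from \<open>low\<close>, which requires 3
    < k - 1; this is where k \<ge> 5 enters.\<close>
  have "T (2 * m + 12) = T (2 * m + 11) - T (m + 7) + T 3 - T 2"
    by (subst rec) (simp add: k coeff_witness_poly add.commute)
  with t''' mid[of "m + 7"] low[of 2] low[of 3] have "T (2 * m + 12) = 2 * of_nat m + 14"
    by (simp add: k)
  then show ?thesis by (simp add: k add.commute)
qed

lemma not_kronecker_witness_poly:
  assumes "k \<ge> 5"
  shows "\<not> kronecker_polynomial (witness_poly k)"
proof
  assume "kronecker_polynomial (witness_poly k)"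
  then have roots: "norm z \<le> 1" if "poly (witness_poly k) z = 0" for z :: complex
    using that by (simp add: kronecker_polynomial_def map_poly_of_int_witness_poly)
  define p where "p = (witness_poly k :: complex poly)"
  have deg: "degree p = 2 * k" and lead: "lead_coeff p = 1"
    using assms by (simp_all add: p_def degree_witness_poly coeff_witness_poly)
  then have "p \<noteq> 0" by auto
  \<comment> \<open>\<open>A\<close> lists the complex roots with multiplicity, so it has exactly 2k
    entries.\<close>
  then obtain A where A': "size A = degree p" "p = smult (lead_coeff p) (\<Prod>r\<in>#A. [:-r, 1:])"
    using alg_closed_imp_factorization by blast
  have A: "size A = 2 * k" "p = (\<Prod>r\<in>#A. [:-r, 1:])"
    using A'(1) deg A'(2)[unfolded lead] by simp_all
  have "norm r \<le> 1" if "r \<in># A" for r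
  proof (rule roots)
    have "[:-r, 1:] dvd p"
      unfolding A(2) using that by (intro dvd_prod_mset) auto
    then show "poly (witness_poly k) r = 0" by (simp add: p_def poly_eq_0_iff_dvd)
  qed
  then have "norm (\<Sum>r\<in>#A. r ^ (2 * k + 3)) \<le> real (2 * k)"
    using norm_sum_mset_power_le[of A "2 * k + 3"] A(1) by simp
  \<comment> \<open>The sequence \<open>T\<close> is shifted by one: its entry 2k + 2 is the power
    sum of exponent 2k + 3.\<close>
  moreover have "(\<Sum>r\<in>#A. r ^ Suc (2 * k + 2)) = of_nat (2 * k + 4)"
  proof (rule witness_poly_power_sum[OF assms])
    have "reflect_poly (\<Prod>r\<in>#A. [:-r, 1:]) = witness_poly k"
      using assms reflect_witness_poly[of k] by (simp add: p_def flip: A(2))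
    then show "fps_deriv (fps_of_poly (witness_poly k)) =
      - (fps_of_poly (witness_poly k) * Abs_fps (\<lambda>n. \<Sum>r\<in>#A. r ^ Suc n))"
      using fps_deriv_reflect_poly_prod_mset[of A] by simp
  qed
  moreover have "Suc (2 * k + 2) = 2 * k + 3" by simp
  ultimately have "norm (of_nat (2 * k + 4) :: complex) \<le> real (2 * k)" by metis
  then show False unfolding norm_of_nat by simp
qed

section \<open>The semigroup\<close>

definition witness :: "nat \<Rightarrow> nat set" where
  "witness k = {0} \<union> {k..2 * k - 2} \<union> {2 * k..}"

lemma gaps_witness:
  assumes "k \<ge> 2"
  shows "gaps (witness k) = insert (2 * k - 1) {1..<k}"
  using assms by (auto simp: gaps_def witness_def)

lemma numerical_semigroup_witness:
  assumes "k \<ge> 2"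
  shows "numerical_semigroup (witness k)"
  using assms gaps_witness[OF assms]
  by (auto simp: numerical_semigroup_def add_submonoid_def witness_def)

lemma frobenius_number_witness:
  assumes "k \<ge> 2"
  shows "frobenius_number (witness k) = 2 * int k - 1"
proof -
  have "Max (gaps (witness k)) = 2 * k - 1"
    unfolding gaps_witness[OF assms] using assms by (intro Max_eqI) auto
  then show ?thesis
    using assms by (simp add: frobenius_number_def gaps_witness of_nat_diff)
qed

text \<open>Reflection z \<mapsto> 2k - 1 - z sends the gaps 1..k-1 onto k..2k-2, the gap 2k - 1 to
  0, and negative integers to values of at least 2k.\<close>

lemma symmetric_witness:
  assumes "k \<ge> 2"
  shows "symmetric_semigroup (witness k)"
proof -
  have "z \<in> int ` witness k \<union> (\<lambda>s. 2 * int k - 1 - int s) ` witness k" for z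
  proof (cases "z \<in> int ` witness k")
    case False
    then have z: "z < 0 \<or> nat z \<notin> witness k"
      by (metis image_eqI linorder_not_less nat_0_le)
    then have "nat (2 * int k - 1 - z) \<in> witness k"
      using assms by (auto simp: witness_def)
    moreover have "z = 2 * int k - 1 - int (nat (2 * int k - 1 - z))"
      using z assms by (auto simp: witness_def)
    ultimately show ?thesis by blast
  qed simp
  then show ?thesis
    unfolding symmetric_semigroup_def frobenius_number_witness[OF assms] by blast
qed

lemma irreducible_elements_witness:
  assumes "k \<ge> 3"
  shows "irreducible_elements (witness k) = {k..2 * k - 2}"
proof
  \<comment> \<open>Two nonzero elements sum to at least 2k.\<close>
  show "{k..2 * k - 2} \<subseteq> irreducible_elements (witness k)"
    using assms by (auto simp: irreducible_elements_def witness_def)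
  show "irreducible_elements (witness k) \<subseteq> {k..2 * k - 2}"
  proof
    fix n assume n: "n \<in> irreducible_elements (witness k)"
    have "\<not> n \<ge> 2 * k"
    proof
      assume ge: "n \<ge> 2 * k"
      obtain a b where "a \<in> witness k" "b \<in> witness k" "n = a + b" "a \<noteq> 0" "b \<noteq> 0"
      \<comment> \<open>Splitting off k fails only when n - k is the gap 2k - 1. Then (k + 1) + (2k
        - 2) serves instead, with k + 1 \<le> 2k - 2 because k \<ge> 3.\<close>
      proof (cases "n = 3 * k - 1")
        case True
        then show ?thesis
          using assms by (intro that[of "k + 1" "2 * k - 2"]) (auto simp: witness_def)
      next
        case False
        then show ?thesis
          using assms ge by (intro that[of k "n - k"]) (auto simp: witness_def)
      qed
      then show False using n by (auto simp: irreducible_elements_def)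
    qed
    then show "n \<in> {k..2 * k - 2}" using n by (auto simp: irreducible_elements_def witness_def)
  qed
qed

lemma embedding_dimension_witness:
  assumes "k \<ge> 3"
  shows "embedding_dimension (witness k) = k - 1"
proof -
  have "add_submonoid (witness k)"
    using numerical_semigroup_witness[of k] assms by (simp add: numerical_semigroup_def)
  then show ?thesis
    using assms
    by (simp add: embedding_dimension_def minimal_generating_set_iff irreducible_elements_witness)
qed

text \<open>Multiplication by x - 1 telescopes the run of gaps 1..k-1 to x^k - x; the isolated gap
  gives x^(2k) - x^(2k-1).\<close>

lemma semigroup_polynomial_witness:
  assumes "k \<ge> 2"
  shows "semigroup_polynomial (witness k) = witness_poly k"
proof -
  have step: "[:-1, 1:] * monom 1 n = monom 1 (Suc n) - (monom 1 n :: int poly)" for n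
    by (simp add: monom_Suc)
  have telescope: "[:-1, 1:] * (\<Sum>g=1..<k. monom 1 g) = monom 1 k - (monom 1 1 :: int poly)"
    unfolding sum_distrib_left step using assms by (intro sum_Suc_diff') simp
  have "2 * k - 1 \<notin> {1..<k}" and "Suc (2 * k - 1) = 2 * k" using assms by auto
  then have "semigroup_polynomial (witness k) =
    1 + ((monom 1 (2 * k) - monom 1 (2 * k - 1)) + (monom 1 k - monom 1 1))"
    unfolding semigroup_polynomial_def gaps_witness[OF assms]
    by (simp only: sum.insert finite_atLeastLessThan distrib_left telescope step not_False_eq_True)
  then show ?thesis by (simp add: witness_poly_def)
qed

lemma not_cyclotomic_witness:
  assumes "k \<ge> 5"
  shows "\<not> cyclotomic_semigroup (witness k)"
  using assms
  by (simp add: cyclotomic_semigroup_def semigroup_polynomial_witness not_kronecker_witness_poly)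

theorem theorem1p4:
  shows "(\<forall>k::nat. k \<ge> 4 \<longrightarrow>
           (\<exists>S. numerical_semigroup S \<and> symmetric_semigroup S \<and>
                embedding_dimension S = k \<and> \<not> cyclotomic_semigroup S)) \<and>
         (\<forall>F::int. odd F \<and> F \<ge> 9 \<longrightarrow>
           (\<exists>S. numerical_semigroup S \<and> symmetric_semigroup S \<and>
                frobenius_number S = F \<and> \<not> cyclotomic_semigroup S))"
proof (intro conjI allI impI)
  fix k :: nat
  assume "k \<ge> 4"
  then show "\<exists>S. numerical_semigroup S \<and> symmetric_semigroup S \<and>
      embedding_dimension S = k \<and> \<not> cyclotomic_semigroup S"
    \<comment> \<open>The parameter exceeds the embedding dimension by one, so k \<ge> 4 gives a
      parameter of at least 5.\<close>
    by (intro exI[of _ "witness (k + 1)"])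
      (simp add: numerical_semigroup_witness symmetric_witness embedding_dimension_witness
        not_cyclotomic_witness)
next
  fix F :: int
  assume F: "odd F \<and> F \<ge> 9"
  then obtain j where j: "F = 2 * j + 1" by (auto elim: oddE)
  \<comment> \<open>The parameter is (F + 1) / 2, and F \<ge> 9 makes it at least 5.\<close>
  then have "nat (j + 1) \<ge> 5" "2 * int (nat (j + 1)) - 1 = F" using F by auto
  then show "\<exists>S. numerical_semigroup S \<and> symmetric_semigroup S \<and>
      frobenius_number S = F \<and> \<not> cyclotomic_semigroup S"
    by (intro exI[of _ "witness (nat (j + 1))"])
      (simp add: numerical_semigroup_witness symmetric_witness frobenius_number_witness
        not_cyclotomic_witness)
qed

end
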